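(* Let $G$ be a (not necessarily commutative) group and $U'=\{(p,q)\in\mathbb{Z}^2:\gcd(p,q)=1,\ pq\neq 0\}$. The map $\psi$ sending a normalized $G$-valued almost Dedekind symbol $D$ to the function $\psi(D)(p,q)=D(p,q)D(q,-p)^{-1}$ on $U'$ is a one-to-one correspondence between the set of normalized $G$-valued almost Dedekind symbols and the set of $G$-valued almost reciprocity functions.
   Context: A $G$-valued almost Dedekind symbol is a map $D:U'\to G$ with $D(p,q)=D(p,p+q)$ whenever $p,q,p+q\neq 0$, and $D(p,-q)=D(-p,q)$ whenever $p,q\neq0$ (with $(p,q)$ coprime); it is normalized if $D(1,1)=1$. A $G$-valued almost reciprocity function is a map $F:U'\to G$ with $F(p,q)=F(p,p+q)F(p+q,q)$ whenever $p,q,p+q\neq0$, and $F(p,q)F(-q,p)=1$, $F(p,-q)=F(-p,q)$ whenever $p,q\neq 0$. *)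

theory Defs
  imports "HOL-Algebra.Group" "HOL-Library.FuncSet" "HOL-Computational_Algebra.Primes"
begin

definition U' :: "(int \<times> int) set" where
  "U' = {(p, q). gcd p q = 1 \<and> p * q \<noteq> 0}"

text \<open>
  Maps from \<open>U'\<close> to \<open>G\<close> are modelled as extensional functions (elements of
  \<open>U' \<rightarrow>\<^sub>E carrier G\<close>), so that equality of HOL functions is equality of maps on \<open>U'\<close>.
\<close>

definition almost_dedekind_symbols :: "('a, 'b) monoid_scheme \<Rightarrow> (int \<times> int \<Rightarrow> 'a) set" where
  "almost_dedekind_symbols G = {D \<in> U' \<rightarrow>\<^sub>E carrier G.
     (\<forall>p q. (p, q) \<in> U' \<and> p + q \<noteq> 0 \<longrightarrow> D (p, q) = D (p, p + q)) \<and>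
     (\<forall>p q. (p, q) \<in> U' \<longrightarrow> D (p, - q) = D (- p, q))}"

definition normalized_almost_dedekind_symbols ::
    "('a, 'b) monoid_scheme \<Rightarrow> (int \<times> int \<Rightarrow> 'a) set" where
  "normalized_almost_dedekind_symbols G =
     {D \<in> almost_dedekind_symbols G. D (1, 1) = \<one>\<^bsub>G\<^esub>}"

definition almost_reciprocity_functions ::
    "('a, 'b) monoid_scheme \<Rightarrow> (int \<times> int \<Rightarrow> 'a) set" where
  "almost_reciprocity_functions G = {F \<in> U' \<rightarrow>\<^sub>E carrier G.
     (\<forall>p q. (p, q) \<in> U' \<and> p + q \<noteq> 0 \<longrightarrow> F (p, q) = F (p, p + q) \<otimes>\<^bsub>G\<^esub> F (p + q, q)) \<and>
     (\<forall>p q. (p, q) \<in> U' \<longrightarrow> F (p, q) \<otimes>\<^bsub>G\<^esub> F (- q, p) = \<one>\<^bsub>G\<^esub>) \<and>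
     (\<forall>p q. (p, q) \<in> U' \<longrightarrow> F (p, - q) = F (- p, q))}"

definition psi :: "('a, 'b) monoid_scheme \<Rightarrow> (int \<times> int \<Rightarrow> 'a) \<Rightarrow> int \<times> int \<Rightarrow> 'a" where
  "psi G D = (\<lambda>(p, q) \<in> U'. D (p, q) \<otimes>\<^bsub>G\<^esub> inv\<^bsub>G\<^esub> D (q, - p))"

end

theory Submission
  imports Defs
begin

text \<open>
  The relation \<open>D(p,q) = F(p,q) D(q,-p)\<close> reconstructs \<open>D\<close> from \<open>F\<close> by the Euclidean algorithm:
  \<open>D\<close> is even, and for \<open>p \<ge> 2\<close> it depends on \<open>q\<close> only modulo \<open>p\<close>, so one may replace \<open>q\<close> by
  \<open>r = q mod p\<close> and recurse to the first argument \<open>r < p\<close>.  For \<open>p = 1\<close> the chain of translations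
  breaks at \<open>q = 0\<close>, leaving the two values \<open>D(1,1) = 1\<close> and \<open>D(1,-1) = F(1,1)\<^sup>-\<^sup>1\<close>.
  That the function \<open>D\<close> reconstructed from an arbitrary \<open>F\<close> satisfies \<open>\<psi>(D) = F\<close> holds by
  construction for
  \<open>0 < q < p\<close>; the antisymmetry and parity of \<open>F\<close> reduce everything else to the case
  \<open>-p < q < 0\<close>, which the three-term relation of \<open>F\<close> carries to the smaller pair \<open>(p + q, q)\<close>.
\<close>

section \<open>Coprime pairs with nonzero entries\<close>

lemma U'_iff: "(p, q) \<in> U' \<longleftrightarrow> coprime p q \<and> p \<noteq> 0 \<and> q \<noteq> 0"
  by (auto simp: U'_def coprime_iff_gcd_eq_1)

lemma U'_neg_left: "(- p, q) \<in> U' \<longleftrightarrow> (p, q) \<in> U'"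
  and U'_neg_right: "(p, - q) \<in> U' \<longleftrightarrow> (p, q) \<in> U'"
  and U'_swap: "(q, p) \<in> U' \<longleftrightarrow> (p, q) \<in> U'"
  by (auto simp: U'_iff coprime_commute)

lemma U'_rotate: "(p, q) \<in> U' \<Longrightarrow> (q, - p) \<in> U'"
  by (auto simp: U'_iff coprime_commute)

lemma U'_add_right: "(p, q) \<in> U' \<Longrightarrow> p + q \<noteq> 0 \<Longrightarrow> (p, p + q) \<in> U'"
  and U'_add_left: "(p, q) \<in> U' \<Longrightarrow> p + q \<noteq> 0 \<Longrightarrow> (p + q, q) \<in> U'"
  by (simp_all add: U'_def add.commute)

text \<open>Coprimality to \<open>p\<close> excludes the residue 0 once \<open>p \<ge> 2\<close>;
  for \<open>p = 1\<close> the residue is always 0, which is why the reduction starts at 2.\<close>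

lemma U'_mod:
  assumes "(p, q) \<in> U'" "p \<ge> 2"
  shows "(p, q mod p) \<in> U'" "q mod p > 0" "q mod p < p"
proof -
  have g: "gcd p (q mod p) = 1"
    using assms by (simp add: U'_def gcd.commute)
  then have "q mod p \<noteq> 0"
    using assms by auto
  then show "(p, q mod p) \<in> U'" "q mod p > 0" "q mod p < p"
    using g assms pos_mod_sign[of p q] by (auto simp: U'_def simp del: pos_mod_sign)
qed

context
  fixes G :: "('a, 'b) monoid_scheme" (structure)
  assumes grp: "group G"
begin

interpretation group G by (rule grp)

section \<open>Defining relations of both kinds of map in usable form\<close>

lemma dedekind_extensional: "D \<in> almost_dedekind_symbols G \<Longrightarrow> D \<in> U' \<rightarrow>\<^sub>E carrier G"
  unfolding almost_dedekind_symbols_def by (elim CollectE conjE)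

lemma dedekind_closed: "D \<in> almost_dedekind_symbols G \<Longrightarrow> x \<in> U' \<Longrightarrow> D x \<in> carrier G"
  by (rule PiE_mem[OF dedekind_extensional])

lemma dedekind_add:
  "D \<in> almost_dedekind_symbols G \<Longrightarrow> (p, q) \<in> U' \<Longrightarrow> p + q \<noteq> 0 \<Longrightarrow> D (p, p + q) = D (p, q)"
  unfolding almost_dedekind_symbols_def by auto

lemma dedekind_neg:
  "D \<in> almost_dedekind_symbols G \<Longrightarrow> (p, q) \<in> U' \<Longrightarrow> D (- p, q) = D (p, - q)"
  unfolding almost_dedekind_symbols_def by auto

lemma reciprocity_extensional:
  "F \<in> almost_reciprocity_functions G \<Longrightarrow> F \<in> U' \<rightarrow>\<^sub>E carrier G"
  unfolding almost_reciprocity_functions_def by (elim CollectE conjE)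

lemma reciprocity_closed: "F \<in> almost_reciprocity_functions G \<Longrightarrow> x \<in> U' \<Longrightarrow> F x \<in> carrier G"
  by (rule PiE_mem[OF reciprocity_extensional])

lemma reciprocity_add:
  "F \<in> almost_reciprocity_functions G \<Longrightarrow> (p, q) \<in> U' \<Longrightarrow> p + q \<noteq> 0 \<Longrightarrow>
    F (p, q) = F (p, p + q) \<otimes> F (p + q, q)"
  unfolding almost_reciprocity_functions_def by auto

lemma reciprocity_mult:
  "F \<in> almost_reciprocity_functions G \<Longrightarrow> (p, q) \<in> U' \<Longrightarrow> F (p, q) \<otimes> F (- q, p) = \<one>"
  unfolding almost_reciprocity_functions_def by auto

lemma reciprocity_neg:
  "F \<in> almost_reciprocity_functions G \<Longrightarrow> (p, q) \<in> U' \<Longrightarrow> F (- p, q) = F (p, - q)"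
  unfolding almost_reciprocity_functions_def by auto

section \<open>From Dedekind symbols to reciprocity functions\<close>

lemma mult_inv_mult_cancel:
  assumes "x \<in> carrier G" "y \<in> carrier G" "z \<in> carrier G"
  shows "(x \<otimes> inv y) \<otimes> (y \<otimes> z) = x \<otimes> z"
proof -
  have "inv y \<otimes> (y \<otimes> z) = z"
    using assms by (simp flip: m_assoc)
  then show ?thesis
    using assms by (simp add: m_assoc)
qed

lemma psi_apply: "(p, q) \<in> U' \<Longrightarrow> psi G D (p, q) = D (p, q) \<otimes> inv D (q, - p)"
  by (simp add: psi_def)

text \<open>The three-term relation is a telescoping product whose inner factors agree by
  translation; the inversion relation is a cancellation once evenness has matched the
  factors.\<close>

lemma psi_reciprocity:
  assumes D: "D \<in> almost_dedekind_symbols G"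
  shows "psi G D \<in> almost_reciprocity_functions G"
proof -
  note cl [simp] = dedekind_closed[OF D]
  note U [simp] = U'_neg_left U'_neg_right
  have "psi G D \<in> U' \<rightarrow>\<^sub>E carrier G"
    by (auto simp: psi_def simp del: U intro!: m_closed inv_closed cl U'_rotate)
  moreover have "psi G D (p, q) = psi G D (p, p + q) \<otimes> psi G D (p + q, q)"
    if pq: "(p, q) \<in> U'" "p + q \<noteq> 0" for p q
  proof -
    note m = U'_add_right[OF pq] U'_add_left[OF pq]
    have nz: "p \<noteq> 0" "q \<noteq> 0" using pq by (auto simp: U'_iff)
    have m': "(p + q, p) \<in> U'" "(q, p + q) \<in> U'" "(q, p) \<in> U'" "(p + q, - p) \<in> U'"
      "(q, - p) \<in> U'" "(q, - (p + q)) \<in> U'"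
      using m pq U'_swap by (auto simp del: minus_add_distrib)
    \<comment> \<open>Translating \<open>- p\<close> by the first argument \<open>p + q\<close>
      gives \<open>q\<close>; in the same way \<open>b\<close> moves \<open>- (p + q)\<close> to
      \<open>- p\<close>.\<close>
    have a: "D (p + q, - p) = D (p + q, q)"
      using dedekind_add[OF D m'(4)] nz by simp
    have b: "D (q, - (p + q)) = D (q, - p)"
      using dedekind_add[OF D m'(6)] nz by simp
    have c: "D (p, p + q) = D (p, q)"
      by (rule dedekind_add[OF D pq])
    have "psi G D (p, p + q) \<otimes> psi G D (p + q, q)
        = (D (p, q) \<otimes> inv D (p + q, q)) \<otimes> (D (p + q, q) \<otimes> inv D (q, - p))"
      unfolding psi_apply[OF m(1)] psi_apply[OF m(2)] a b c ..
    also have "\<dots> = psi G D (p, q)"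
      using pq m m' by (simp add: psi_apply mult_inv_mult_cancel)
    finally show ?thesis by simp
  qed
  moreover have "psi G D (p, q) \<otimes> psi G D (- q, p) = \<one>" if pq: "(p, q) \<in> U'" for p q
  proof -
    have m: "(q, p) \<in> U'" "(- q, p) \<in> U'" "(p, - (- q)) \<in> U'"
      using pq U'_swap by auto
    have "psi G D (p, q) \<otimes> psi G D (- q, p)
        = (D (p, q) \<otimes> inv D (q, - p)) \<otimes> (D (q, - p) \<otimes> inv D (p, q))"
      using pq m by (simp add: psi_apply dedekind_neg[OF D])
    also have "\<dots> = \<one>"
      using pq m by (simp add: mult_inv_mult_cancel)
    finally show ?thesis .
  qed
  moreover have "psi G D (p, - q) = psi G D (- p, q)" if pq: "(p, q) \<in> U'" for p q
  proof -
    have m: "(q, p) \<in> U'" using pq U'_swap by auto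
    then show ?thesis
      using pq dedekind_neg[OF D, of q "- p"] by (simp add: psi_apply dedekind_neg[OF D])
  qed
  ultimately show ?thesis
    by (auto simp: almost_reciprocity_functions_def)
qed

section \<open>Reconstruction of a symbol by the Euclidean algorithm\<close>

function euclid_symbol :: "(int \<times> int \<Rightarrow> 'a) \<Rightarrow> int \<Rightarrow> int \<Rightarrow> 'a" where
  "euclid_symbol F p q =
    (if p \<ge> 2 then F (p, q mod p) \<otimes> euclid_symbol F (q mod p) (- p)
     else if q > 0 then \<one> else inv F (1, 1))"
  by pat_completeness auto
termination
  \<comment> \<open>In the recursive branch the first argument drops from \<open>p\<close> to
    \<open>q mod p < p\<close>.\<close>
  by (relation "measure (\<lambda>(F, p, q). nat p)") auto

declare euclid_symbol.simps [simp del]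

text \<open>Evenness makes a symbol invariant under a simultaneous sign change, so its values at
  positive \<open>p\<close> determine it. On such pairs of \<open>U'\<close> the recursion keeps its
  first argument positive, and its last two branches serve \<open>p = 1\<close>.\<close>

definition dedekind_of :: "(int \<times> int \<Rightarrow> 'a) \<Rightarrow> int \<times> int \<Rightarrow> 'a" where
  "dedekind_of F =
    (\<lambda>(p, q) \<in> U'. if p > 0 then euclid_symbol F p q else euclid_symbol F (- p) (- q))"

lemma euclid_symbol_closed:
  assumes F: "F \<in> almost_reciprocity_functions G"
  shows "(p, q) \<in> U' \<Longrightarrow> p > 0 \<Longrightarrow> euclid_symbol F p q \<in> carrier G"
proof (induction "nat p" arbitrary: p q rule: less_induct)
  case less
  show ?case
  proof (cases "p \<ge> 2")
    case True
    note m = U'_mod[OF less.prems(1) True]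
    have "(q mod p, - p) \<in> U'" by (rule U'_rotate[OF m(1)])
    then have "euclid_symbol F (q mod p) (- p) \<in> carrier G"
      using m less.prems by (intro less.hyps) auto
    then show ?thesis
      using True reciprocity_closed[OF F m(1)] by (subst euclid_symbol.simps) simp
  next
    case False
    have "F (1, 1) \<in> carrier G" by (rule reciprocity_closed[OF F]) (simp add: U'_iff)
    then show ?thesis using False by (subst euclid_symbol.simps) simp
  qed
qed

text \<open>For \<open>p \<ge> 2\<close> only the residue of \<open>q\<close> enters. For
  \<open>p = 1\<close> only the sign of \<open>q\<close> enters, and the step from \<open>q\<close>
  to \<open>q + 1\<close> preserves it because neither is 0.\<close>

lemma euclid_symbol_add:
  assumes "p > 0" "q \<noteq> 0" "p + q \<noteq> 0"
  shows "euclid_symbol F p (p + q) = euclid_symbol F p q"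
proof (cases "p \<ge> 2")
  case True
  then show ?thesis by (simp add: euclid_symbol.simps[of F p])
next
  case False
  then have "p = 1" using assms by simp
  then show ?thesis using assms by (auto simp: euclid_symbol.simps[of F 1])
qed

lemma dedekind_of_dedekind:
  assumes F: "F \<in> almost_reciprocity_functions G"
  shows "dedekind_of F \<in> almost_dedekind_symbols G"
proof -
  have "dedekind_of F (p, q) \<in> carrier G" if "(p, q) \<in> U'" for p q
  proof -
    have "p \<noteq> 0" using that by (simp add: U'_iff)
    then show ?thesis
      using that euclid_symbol_closed[OF F, of p q] euclid_symbol_closed[OF F, of "- p" "- q"]
      by (auto simp: dedekind_of_def U'_neg_left U'_neg_right)
  qed
  then have "dedekind_of F \<in> U' \<rightarrow>\<^sub>E carrier G"
    by (auto simp: dedekind_of_def)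
  moreover have "dedekind_of F (p, q) = dedekind_of F (p, p + q)"
    if pq: "(p, q) \<in> U'" "p + q \<noteq> 0" for p q
  proof -
    have "p \<noteq> 0" "q \<noteq> 0" using pq by (simp_all add: U'_iff)
    then show ?thesis
      using pq U'_add_right[OF pq] euclid_symbol_add[of p q F] euclid_symbol_add[of "- p" "- q" F]
      by (auto simp: dedekind_of_def)
  qed
  moreover have "dedekind_of F (p, - q) = dedekind_of F (- p, q)" if "(p, q) \<in> U'" for p q
  proof -
    have "p \<noteq> 0" using that by (simp add: U'_iff)
    then show ?thesis using that by (auto simp: dedekind_of_def U'_neg_left U'_neg_right)
  qed
  ultimately show ?thesis
    by (auto simp: almost_dedekind_symbols_def)
qed

section \<open>The reconstruction is a right inverse of \<open>psi\<close>\<close>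

lemma dedekind_of_1_1: "dedekind_of F (1, 1) = \<one>"
  and dedekind_of_1_m1: "dedekind_of F (1, - 1) = inv F (1, 1)"
  by (simp_all add: dedekind_of_def U'_iff euclid_symbol.simps)

text \<open>This is \<open>psi G (dedekind_of F) = F\<close> with the inverse cleared, a form suited
  to induction on \<open>|p| + |q|\<close>.\<close>

lemma dedekind_of_relation:
  assumes F: "F \<in> almost_reciprocity_functions G"
  shows "(p, q) \<in> U' \<Longrightarrow> dedekind_of F (p, q) = F (p, q) \<otimes> dedekind_of F (q, - p)"
proof (induction "nat (\<bar>p\<bar> + \<bar>q\<bar>)" arbitrary: p q rule: less_induct)
  case less
  define D where "D = dedekind_of F"
  have D: "D \<in> almost_dedekind_symbols G"
    unfolding D_def by (rule dedekind_of_dedekind[OF F])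
  note cl = dedekind_closed[OF D] reciprocity_closed[OF F]
  \<comment> \<open>Only the size of \<open>(a, b)\<close> is tied to \<open>(p, q)\<close>, so the
    claim also covers sign changes and rotations of \<open>(p, q)\<close> under the same induction
    hypothesis.\<close>
  have base: "D (a, b) = F (a, b) \<otimes> D (b, - a)"
    if ab: "(a, b) \<in> U'" "nat (\<bar>a\<bar> + \<bar>b\<bar>) = nat (\<bar>p\<bar> + \<bar>q\<bar>)" "a > 0" "\<bar>b\<bar> \<le> a" for a b
  proof -
    have nz: "a \<noteq> 0" "b \<noteq> 0" using ab by (auto simp: U'_iff)
    have U11: "(1, 1) \<in> U'" "(1, - 1) \<in> U'" "(- 1, 1) \<in> U'" by (auto simp: U'_iff)
    consider "a = 1" "b = 1" | "a = 1" "b = - 1" | "a \<ge> 2" "\<bar>b\<bar> < a"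
    proof (cases "a \<ge> 2")
      case True
      have "\<bar>b\<bar> \<noteq> a"
      proof
        assume "\<bar>b\<bar> = a"
        then have "a dvd b" by auto
        then have "gcd a b = a" using ab by simp
        then show False using ab True by (simp add: U'_def)
      qed
      then show ?thesis using that(3) True ab by auto
    next
      case False
      then show ?thesis using that ab nz by fastforce
    qed
    then show ?thesis
    proof cases
      case 1
      \<comment> \<open>The claim reads \<open>\<one> = F (1, 1) \<otimes> inv F (1, 1)\<close>,
        which explains the value chosen at \<open>(1, - 1)\<close>.\<close>
      then show ?thesis
        using cl U11 by (simp add: D_def dedekind_of_1_1 dedekind_of_1_m1)
    next
      case 2
      have "F (1, - 1) = F (- 1, 1)" using reciprocity_neg[OF F U11(1)] by simp
      moreover have "F (- 1, 1) = inv F (1, 1)"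
        using inv_equality[OF reciprocity_mult[OF F U11(1)] cl(2)[OF U11(3)] cl(2)[OF U11(1)]]
          inv_inv[OF cl(2)[OF U11(3)]] by simp
      moreover have "D (- 1, - 1) = D (1, 1)" using dedekind_neg[OF D U11(2)] by simp
      ultimately show ?thesis
        using 2 cl U11 by (simp add: D_def dedekind_of_1_1 dedekind_of_1_m1)
    next
      case 3
      show ?thesis
      proof (cases "b > 0")
        case True
        then have "b mod a = b" using 3 by simp
        moreover have "(b, - a) \<in> U'" by (rule U'_rotate[OF ab(1)])
        ultimately show ?thesis
          using ab True 3 by (simp add: D_def dedekind_of_def euclid_symbol.simps[of F a])
      next
        case False
        then have b: "b < 0" "a + b > 0" using nz 3 by auto
        have ab0: "a + b \<noteq> 0" using b by simp
        note m = U'_add_right[OF ab(1) ab0] U'_add_left[OF ab(1) ab0]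
        have m': "(a + b, - a) \<in> U'" "(b, - (a + b)) \<in> U'" "(b, - a) \<in> U'"
          using m ab U'_swap U'_neg_right by blast+
        have e: "D (a + b, - a) = D (a + b, b)" "D (b, - (a + b)) = D (b, - a)"
          using dedekind_add[OF D m'(1)] dedekind_add[OF D m'(2)] nz by simp_all
        have "D (a, b) = D (a, a + b)"
          using dedekind_add[OF D ab(1) ab0] by simp
        also have "\<dots> = F (a, a + b) \<otimes> D (a + b, - a)"
        proof -
          \<comment> \<open>Since \<open>0 < a + b < a\<close>, the pair \<open>(a, a + b)\<close>
            is already reduced, and the claim is one unfolding of the recursion.\<close>
          have "(a + b) mod a = a + b" using b by (intro mod_pos_pos_trivial) auto
          then show ?thesis
            using b m m' ab 3
            by (simp add: D_def dedekind_of_def euclid_symbol.simps[of F a] del: mod_add_self1)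
        qed
        also have "D (a + b, - a) = F (a + b, b) \<otimes> D (b, - a)"
        proof -
          \<comment> \<open>As \<open>b < 0\<close>, the pair \<open>(a + b, b)\<close> has size
            \<open>a\<close>, less than \<open>a + |b|\<close>.\<close>
          have "D (a + b, b) = F (a + b, b) \<otimes> D (b, - (a + b))"
            unfolding D_def using m(2) ab b nz by (intro less.hyps) auto
          then show ?thesis using e by simp
        qed
        also have "F (a, a + b) \<otimes> \<dots> = F (a, b) \<otimes> D (b, - a)"
          using reciprocity_add[OF F ab(1) ab0] cl m m' by (simp add: m_assoc)
        finally show ?thesis .
      qed
    qed
  qed
  have base2: "D (a, b) = F (a, b) \<otimes> D (b, - a)"
    if ab: "(a, b) \<in> U'" "nat (\<bar>a\<bar> + \<bar>b\<bar>) = nat (\<bar>p\<bar> + \<bar>q\<bar>)" "\<bar>b\<bar> \<le> \<bar>a\<bar>" for a b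
  proof (cases "a > 0")
    case True
    then show ?thesis using base ab by simp
  next
    case False
    have n: "(- a, - b) \<in> U'" "(a, - b) \<in> U'" "(b, a) \<in> U'" "a \<noteq> 0"
      using ab U'_swap by (auto simp: U'_neg_left U'_neg_right U'_iff coprime_commute)
    \<comment> \<open>Both sides of the relation are invariant under a simultaneous sign
      change.\<close>
    have "D (- a, - b) = F (- a, - b) \<otimes> D (- b, - (- a))"
      using n ab False by (intro base) auto
    then show ?thesis
      using dedekind_neg[OF D n(2)] dedekind_neg[OF D n(3)] reciprocity_neg[OF F n(2)] by simp
  qed
  have "D (p, q) = F (p, q) \<otimes> D (q, - p)"
  proof (cases "\<bar>q\<bar> \<le> \<bar>p\<bar>")
    case True
    then show ?thesis using base2 less.prems by simp
  next
    case False
    have n: "(- q, p) \<in> U'" "(q, p) \<in> U'" "(q, - p) \<in> U'"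
      using less.prems by (auto simp: U'_iff coprime_commute)
    \<comment> \<open>The rotated pair \<open>(- q, p)\<close> has the dominant entry first;
      multiplying its relation by \<open>F (p, q)\<close> on the left cancels
      \<open>F (- q, p)\<close>.\<close>
    have "D (- q, p) = F (- q, p) \<otimes> D (p, - (- q))"
      using n False by (intro base2) auto
    then have "D (q, - p) = F (- q, p) \<otimes> D (p, q)"
      using dedekind_neg[OF D n(2)] by simp
    then have "F (p, q) \<otimes> D (q, - p) = (F (p, q) \<otimes> F (- q, p)) \<otimes> D (p, q)"
      using cl n less.prems by (simp add: m_assoc)
    then show ?thesis
      using cl less.prems reciprocity_mult[OF F less.prems] by simp
  qed
  then show ?case by (simp add: D_def)
qed

lemma psi_dedekind_of:
  assumes F: "F \<in> almost_reciprocity_functions G"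
  shows "psi G (dedekind_of F) = F"
proof
  fix x
  show "psi G (dedekind_of F) x = F x"
  proof (cases "x \<in> U'")
    case True
    obtain p q where x: "x = (p, q)" by (rule prod.exhaust)
    have pq: "(p, q) \<in> U'" using True x by simp
    have "dedekind_of F (q, - p) \<in> carrier G"
      by (rule dedekind_closed[OF dedekind_of_dedekind[OF F] U'_rotate[OF pq]])
    then show ?thesis
      unfolding x psi_apply[OF pq] dedekind_of_relation[OF F pq]
      using reciprocity_closed[OF F pq] by (simp add: m_assoc)
  next
    case False
    \<comment> \<open>Outside \<open>U'\<close> both maps are \<open>undefined\<close>.\<close>
    then show ?thesis
      using PiE_arb[OF reciprocity_extensional[OF F] False] by (simp add: psi_def)
  qed
qed

section \<open>The reconstruction is a left inverse of \<open>psi\<close>\<close>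

lemma dedekind_add_mult:
  assumes D: "D \<in> almost_dedekind_symbols G" and pq: "(p, q) \<in> U'" and p: "p \<ge> 2"
  shows "(p, q + int k * p) \<in> U' \<and> D (p, q + int k * p) = D (p, q)"
proof (induction k)
  case 0
  then show ?case using pq by simp
next
  case (Suc k)
  let ?q = "q + int k * p"
  \<comment> \<open>The chain of translations never meets 0: otherwise \<open>(p, - p)\<close> would
    be a coprime pair with \<open>p \<ge> 2\<close>.\<close>
  have "p + ?q \<noteq> 0"
  proof
    assume "p + ?q = 0"
    then have "?q = - p" by linarith
    then have "(p, - p) \<in> U'" using Suc by (simp only:)
    then show False using p by (simp add: U'_def)
  qed
  then have "(p, p + ?q) \<in> U' \<and> D (p, p + ?q) = D (p, q)"
    using Suc U'_add_right[of p ?q] dedekind_add[OF D, of p ?q] by simp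
  moreover have "p + ?q = q + int (Suc k) * p" by (simp add: algebra_simps)
  ultimately show ?case by (simp only:)
qed

lemma dedekind_mod:
  assumes D: "D \<in> almost_dedekind_symbols G" and pq: "(p, q) \<in> U'" and p: "p \<ge> 2"
  shows "D (p, q mod p) = D (p, q)"
\<comment> \<open>Chains only add \<open>p\<close>, so a nonnegative quotient leads from the residue
  up to \<open>q\<close>, and a negative one from \<open>q\<close> up to the residue.\<close>
proof (cases "q div p \<ge> 0")
  case True
  then have "q = q mod p + int (nat (q div p)) * p" by simp
  then show ?thesis
    using dedekind_add_mult[OF D U'_mod(1)[OF pq p] p, of "nat (q div p)"] by metis
next
  case False
  then have "q mod p = q + int (nat (- (q div p))) * p"
    using minus_div_mult_eq_mod[of q p] by auto
  then show ?thesis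
    using dedekind_add_mult[OF D pq p, of "nat (- (q div p))"] by metis
qed

lemma dedekind_1_pos:
  assumes D: "D \<in> almost_dedekind_symbols G" and "q \<ge> 1"
  shows "D (1, q) = D (1, 1)"
  using \<open>q \<ge> 1\<close>
proof (induction q rule: int_ge_induct)
  case base
  then show ?case ..
next
  case (step i)
  then show ?case using dedekind_add[OF D, of 1 i] by (simp add: U'_iff add.commute)
qed

lemma dedekind_1_neg:
  assumes D: "D \<in> almost_dedekind_symbols G" and "q \<le> - 1"
  shows "D (1, q) = D (1, - 1)"
  using \<open>q \<le> - 1\<close>
proof (induction q rule: int_le_induct)
  case base
  then show ?case ..
next
  case (step i)
  then show ?case using dedekind_add[OF D, of 1 "i - 1"] by (simp add: U'_iff)
qed

text \<open>With \<open>r = q mod p\<close>, the identity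
  \<open>D (p, r) = psi G D (p, r) \<otimes> D (r, - p)\<close> determines \<open>D\<close>
  recursively. At \<open>p = 1\<close>, normalization fixes the value for \<open>q > 0\<close>, and
  \<open>psi G D (1, 1)\<close> then fixes the one for \<open>q < 0\<close>.\<close>

lemma dedekind_eq_euclid_symbol:
  assumes D: "D \<in> almost_dedekind_symbols G" and norm: "D (1, 1) = \<one>"
  shows "(p, q) \<in> U' \<Longrightarrow> p > 0 \<Longrightarrow> D (p, q) = euclid_symbol (psi G D) p q"
proof (induction "nat p" arbitrary: p q rule: less_induct)
  case less
  show ?case
  proof (cases "p \<ge> 2")
    case True
    note m = U'_mod[OF less.prems(1) True]
    have m': "(q mod p, - p) \<in> U'" by (rule U'_rotate[OF m(1)])
    then have "euclid_symbol (psi G D) (q mod p) (- p) = D (q mod p, - p)"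
      using m less.prems by (intro less.hyps[symmetric]) auto
    then have "euclid_symbol (psi G D) p q = psi G D (p, q mod p) \<otimes> D (q mod p, - p)"
      using True by (subst euclid_symbol.simps) simp
    also have "\<dots> = D (p, q mod p)"
      using m(1) m' dedekind_closed[OF D] by (simp add: psi_apply m_assoc)
    finally show ?thesis
      using dedekind_mod[OF D less.prems(1) True] by simp
  next
    case False
    then have p: "p = 1" using less.prems by simp
    have q: "q \<noteq> 0" using less.prems by (simp add: U'_iff)
    have "D (1, - 1) \<in> carrier G" by (rule dedekind_closed[OF D]) (simp add: U'_iff)
    then have "inv (psi G D (1, 1)) = D (1, - 1)"
      using norm by (simp add: psi_apply U'_iff)
    then show ?thesis
      using p q norm dedekind_1_pos[OF D, of q] dedekind_1_neg[OF D, of q]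
      by (simp add: euclid_symbol.simps)
  qed
qed

lemma dedekind_of_psi:
  assumes D: "D \<in> almost_dedekind_symbols G" and norm: "D (1, 1) = \<one>"
  shows "dedekind_of (psi G D) = D"
proof
  fix x
  show "dedekind_of (psi G D) x = D x"
  proof (cases "x \<in> U'")
    case True
    obtain p q where x: "x = (p, q)" by (rule prod.exhaust)
    have n: "(- p, - q) \<in> U'" "(p, - q) \<in> U'" "p \<noteq> 0"
      using True x by (auto simp: U'_neg_left U'_neg_right U'_iff)
    then show ?thesis
      using True x dedekind_eq_euclid_symbol[OF D norm, of p q] dedekind_neg[OF D n(2)]
        dedekind_eq_euclid_symbol[OF D norm n(1)]
      by (simp add: dedekind_of_def)
  next
    case False
    then show ?thesis
      using PiE_arb[OF dedekind_extensional[OF D] False] by (simp add: dedekind_of_def)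
  qed
qed

section \<open>Bijectivity from the two-sided inverse\<close>

lemma bij_betw_psi:
  "bij_betw (psi G) (normalized_almost_dedekind_symbols G) (almost_reciprocity_functions G)"
  by (rule bij_betw_byWitness[where f' = dedekind_of])
    (auto simp: normalized_almost_dedekind_symbols_def dedekind_of_psi psi_dedekind_of
      psi_reciprocity dedekind_of_dedekind dedekind_of_1_1)

end

theorem theorem3p10:
  fixes G :: "('a, 'b) monoid_scheme"
  assumes "group G"
  shows "bij_betw (psi G) (normalized_almost_dedekind_symbols G) (almost_reciprocity_functions G)"
  using assms by (rule bij_betw_psi)

end
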